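(* Let $T$ be a tree of order $n\ge 4$ and let $P_n$ be the path on $n$ vertices. If $T$ has $s$ internal (non-pendent) vertices and $\left(\frac{\pi-2}{\pi}\right)n\ge s+2-\frac{2s}{n}$, then $LE(T)\ge LE(P_n)$.
   Context: For a graph $G$ with $n$ vertices and $m$ edges, let $\mu_1\ge\dots\ge\mu_n$ be the eigenvalues of the Laplacian matrix $L(G)=D(G)-A(G)$ and $\overline{d}=2m/n$ the average degree. The Laplacian energy is $LE(G)=\sum_{i=1}^n|\mu_i-\overline{d}|$. A pendent vertex has degree $1$; internal vertices are those of degree greater than $1$. *)

theory Defs
  imports
    Complex_Main
    Graph_Theory.Digraph_Component
    Jordan_Normal_Form.Char_Poly
begin

text \<open>
  A finite simple graph is a \<^locale>\<open>graph\<close> of the Graph Theory entry: a finite symmetric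
  digraph without loops or parallel arcs. Every undirected edge corresponds to a pair of opposite
  arcs, so that the degree of a vertex is its \<^const>\<open>out_degree\<close>.
\<close>

definition edges :: "('a, 'b) pre_digraph \<Rightarrow> 'a set set" where
  "edges G = {{u, v} | u v. u \<rightarrow>\<^bsub>G\<^esub> v}"

text \<open>
  The library's \<^const>\<open>tree\<close> does not apply to symmetric digraphs: there the closed walk
  \<open>a, b, a\<close> along an edge counts as a \<^const>\<open>pre_digraph.cycle\<close>. As a \<^locale>\<open>graph\<close> has neither
  loops nor parallel arcs, the cycles of the undirected graph are those of length at least 3.
\<close>

definition undirected_tree :: "('a, 'b) pre_digraph \<Rightarrow> bool" where
  "undirected_tree G \<longleftrightarrow>
     graph G \<and> Digraph_Component.connected G \<and> \<not> (\<exists>p. pre_digraph.cycle G p \<and> length p \<ge> 3)"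

definition internal_verts :: "('a, 'b) pre_digraph \<Rightarrow> 'a set" where
  "internal_verts G = {v \<in> verts G. out_degree G v > 1}"

definition path_graph :: "nat \<Rightarrow> (nat, nat \<times> nat) pre_digraph" where
  "path_graph n = with_proj
     \<lparr>pverts = {..<n}, parcs = {(i, j). i < n \<and> j < n \<and> (j = Suc i \<or> i = Suc j)}\<rparr>"

lemma graph_path_graph: "graph (path_graph n)"
proof -
  have "finite {(i, j). i < n \<and> j < n \<and> (j = Suc i \<or> i = Suc j)}"
    by (rule finite_subset[of _ "{..<n} \<times> {..<n}"]) auto
  then interpret pair_graph
    "\<lparr>pverts = {..<n}, parcs = {(i, j). i < n \<and> j < n \<and> (j = Suc i \<or> i = Suc j)}\<rparr>"
    by unfold_locales (auto simp: symmetric_def sym_def)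
  show ?thesis
    unfolding path_graph_def by (rule pair_graphD_graph)
qed

text \<open>
  The matrices of \<open>G\<close> depend on an enumeration \<open>xs\<close> of the vertices.
\<close>

definition degree_mat :: "('a, 'b) pre_digraph \<Rightarrow> 'a list \<Rightarrow> real mat" where
  "degree_mat G xs = mat (length xs) (length xs)
     (\<lambda>(i, j). if i = j then real (out_degree G (xs ! i)) else 0)"

definition adjacency_mat :: "('a, 'b) pre_digraph \<Rightarrow> 'a list \<Rightarrow> real mat" where
  "adjacency_mat G xs = mat (length xs) (length xs)
     (\<lambda>(i, j). if xs ! i \<rightarrow>\<^bsub>G\<^esub> xs ! j then 1 else 0)"

definition laplacian_mat :: "('a, 'b) pre_digraph \<Rightarrow> 'a list \<Rightarrow> real mat" where
  "laplacian_mat G xs = degree_mat G xs - adjacency_mat G xs"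

text \<open>
  The Laplacian eigenvalues as a multiset, with algebraic multiplicities, for some enumeration of
  the vertices; by lemma \<open>laplacian_eigenvalues_eq\<close> the choice does not matter. No
  eigenvalue is lost by taking real roots, see lemma \<open>size_laplacian_eigenvalues\<close>.
\<close>

definition laplacian_eigenvalues :: "('a, 'b) pre_digraph \<Rightarrow> real multiset" where
  "laplacian_eigenvalues G =
     proots (char_poly (laplacian_mat G (SOME xs. distinct xs \<and> set xs = verts G)))"

definition average_degree :: "('a, 'b) pre_digraph \<Rightarrow> real" where
  "average_degree G = 2 * real (card (edges G)) / real (card (verts G))"

definition laplacian_energy :: "('a, 'b) pre_digraph \<Rightarrow> real" where
  "laplacian_energy G = (\<Sum>\<mu>\<in>#laplacian_eigenvalues G. \<bar>\<mu> - average_degree G\<bar>)"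

lemma similar_mat_reindex:
  fixes A :: "'a :: field mat"
  assumes A: "A \<in> carrier_mat n n" and f: "bij_betw f {..<n} {..<n}"
  shows "similar_mat (mat n n (\<lambda>(i, j). A $$ (f i, f j))) A"
proof -
  define P :: "'a mat" where "P = mat n n (\<lambda>(i, j). if j = f i then 1 else 0)"
  define Q :: "'a mat" where "Q = mat n n (\<lambda>(i, j). if i = f j then 1 else 0)"
  have fn: "f i < n" if "i < n" for i
    using f that by (auto simp: bij_betw_def)
  have finj: "f i = f j \<longleftrightarrow> i = j" if "i < n" "j < n" for i j
    using f that by (auto simp: bij_betw_def inj_on_def)
  have P: "P \<in> carrier_mat n n" and Q: "Q \<in> carrier_mat n n"
    by (auto simp: P_def Q_def)
  have PB: "(P * B) $$ (i, j) = B $$ (f i, j)"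
    if "B \<in> carrier_mat n n" "i < n" "j < n" for B i j
  proof -
    have "(P * B) $$ (i, j) = (\<Sum>k\<in>{0..<n}. (if k = f i then 1 else 0) * B $$ (k, j))"
      using that P by (auto simp: P_def scalar_prod_def)
    also have "\<dots> = (\<Sum>k\<in>{0..<n}. if k = f i then B $$ (k, j) else 0)"
      by (rule sum.cong) auto
    finally have "(P * B) $$ (i, j) = (\<Sum>k\<in>{0..<n}. if k = f i then B $$ (k, j) else 0)" .
    then show ?thesis using fn[OF that(2)] by simp
  qed
  have BQ: "(B * Q) $$ (i, j) = B $$ (i, f j)"
    if "B \<in> carrier_mat n n" "i < n" "j < n" for B i j
  proof -
    have "(B * Q) $$ (i, j) = (\<Sum>k\<in>{0..<n}. B $$ (i, k) * (if k = f j then 1 else 0))"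
      using that Q by (auto simp: Q_def scalar_prod_def)
    also have "\<dots> = (\<Sum>k\<in>{0..<n}. if k = f j then B $$ (i, k) else 0)"
      by (rule sum.cong) auto
    finally have "(B * Q) $$ (i, j) = (\<Sum>k\<in>{0..<n}. if k = f j then B $$ (i, k) else 0)" .
    then show ?thesis using fn[OF that(3)] by simp
  qed
  have PQ: "P * Q = 1\<^sub>m n"
    by (rule eq_matI) (use P Q fn finj in \<open>auto simp: PB Q_def simp del: index_mult_mat(1)\<close>)
  have QP: "Q * P = 1\<^sub>m n"
    by (rule mat_mult_left_right_inverse[OF P Q PQ])
  have "mat n n (\<lambda>(i, j). A $$ (f i, f j)) = P * A * Q"
    by (rule eq_matI) (use A P Q fn in \<open>auto simp: BQ PB simp del: index_mult_mat(1)\<close>)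
  then show ?thesis
    using A P Q PQ QP by (intro similar_matI[of _ _ P Q n]) auto
qed

lemma char_poly_laplacian_mat_cong:
  assumes xs: "distinct xs" and ys: "distinct ys" and eq: "set xs = set ys"
  shows "char_poly (laplacian_mat G xs) = char_poly (laplacian_mat G ys)"
proof -
  let ?n = "length ys"
  have len: "length xs = ?n"
    using assms by (metis distinct_card)
  define f where "f i = inv_into {..<?n} ((!) ys) (xs ! i)" for i
  have bx: "bij_betw ((!) xs) {..<?n} (set ys)" and by': "bij_betw ((!) ys) {..<?n} (set ys)"
    using bij_betw_nth[OF xs] bij_betw_nth[OF ys] len eq by auto
  have f: "bij_betw f {..<?n} {..<?n}"
    using bij_betw_trans[OF bx bij_betw_inv_into[OF by']] by (simp add: f_def comp_def cong: bij_betw_cong)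
  have nth: "ys ! f i = xs ! i" and fn: "f i < ?n" if "i < ?n" for i
  proof -
    have "xs ! i \<in> set ys"
      using that len eq by (metis nth_mem)
    then show "ys ! f i = xs ! i"
      unfolding f_def using by' by (metis bij_betw_inv_into_right)
    show "f i < ?n"
      using f that by (auto simp: bij_betw_def)
  qed
  have finj: "f i = f j \<longleftrightarrow> i = j" if "i < ?n" "j < ?n" for i j
    using f that by (auto simp: bij_betw_def inj_on_def)
  have "laplacian_mat G xs = mat ?n ?n (\<lambda>(i, j). laplacian_mat G ys $$ (f i, f j))"
    by (rule eq_matI)
      (auto simp: laplacian_mat_def degree_mat_def adjacency_mat_def len nth fn finj)
  moreover have "laplacian_mat G ys \<in> carrier_mat ?n ?n"
    by (auto simp: laplacian_mat_def degree_mat_def adjacency_mat_def)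
  ultimately show ?thesis
    using similar_mat_reindex[OF _ f] char_poly_similar by metis
qed

lemma laplacian_eigenvalues_eq:
  assumes "distinct xs" "set xs = verts G"
  shows "laplacian_eigenvalues G = proots (char_poly (laplacian_mat G xs))"
proof -
  have "distinct (SOME xs. distinct xs \<and> set xs = verts G) \<and>
      set (SOME xs. distinct xs \<and> set xs = verts G) = verts G"
    by (rule someI[of _ xs]) (use assms in auto)
  then show ?thesis
    unfolding laplacian_eigenvalues_def using assms char_poly_laplacian_mat_cong by metis
qed

lemma symmetric_real_mat_eigenvalue_real:
  fixes A :: "real mat"
  assumes A: "A \<in> carrier_mat n n"
    and sym: "\<And>i j. i < n \<Longrightarrow> j < n \<Longrightarrow> A $$ (i, j) = A $$ (j, i)"
    and ev: "eigenvalue (map_mat complex_of_real A) a"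
  shows "Im a = 0"
proof -
  obtain v where v: "v \<in> carrier_vec n" "v \<noteq> 0\<^sub>v n"
    and eq: "map_mat complex_of_real A *\<^sub>v v = a \<cdot>\<^sub>v v"
    using ev A by (auto simp: eigenvalue_def eigenvector_def)
  have row: "(\<Sum>j<n. complex_of_real (A $$ (i, j)) * v $ j) = a * v $ i" if "i < n" for i
  proof -
    have "(map_mat complex_of_real A *\<^sub>v v) $ i = (\<Sum>j<n. complex_of_real (A $$ (i, j)) * v $ j)"
      using that A v by (auto simp: scalar_prod_def atLeast0LessThan)
    then show ?thesis using eq that v by simp
  qed
  define S where "S = (\<Sum>i<n. \<Sum>j<n. cnj (v $ i) * complex_of_real (A $$ (i, j)) * v $ j)"
  define N where "N = (\<Sum>i<n. (cmod (v $ i))\<^sup>2)"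
  have "S = (\<Sum>i<n. cnj (v $ i) * (\<Sum>j<n. complex_of_real (A $$ (i, j)) * v $ j))"
    by (simp add: S_def sum_distrib_left mult.assoc)
  also have "\<dots> = (\<Sum>i<n. a * (v $ i * cnj (v $ i)))"
    by (intro sum.cong refl) (simp only: row lessThan_iff, simp add: mult_ac)
  also have "\<dots> = a * complex_of_real N"
    by (simp only: N_def sum_distrib_left[symmetric] of_real_sum complex_norm_square)
  finally have S: "S = a * complex_of_real N" .
  have "cnj S = (\<Sum>i<n. \<Sum>j<n. v $ i * complex_of_real (A $$ (i, j)) * cnj (v $ j))"
    by (simp add: S_def)
  also have "\<dots> = (\<Sum>j<n. \<Sum>i<n. v $ i * complex_of_real (A $$ (i, j)) * cnj (v $ j))"
    by (rule sum.swap)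
  also have "\<dots> = S"
    unfolding S_def by (intro sum.cong) (auto simp: sym mult_ac)
  finally have "cnj a * complex_of_real N = a * complex_of_real N"
    using S by simp
  moreover have "N \<noteq> 0"
  proof
    assume "N = 0"
    then have "\<forall>i\<in>{..<n}. (cmod (v $ i))\<^sup>2 = 0"
      unfolding N_def by (subst (asm) sum_nonneg_eq_0_iff) auto
    then have "v = 0\<^sub>v n"
      using v(1) by (intro eq_vecI) auto
    with v(2) show False by simp
  qed
  ultimately have "cnj a = a"
    by simp
  then show ?thesis
    by (simp add: complex_eq_iff)
qed

lemma size_proots_char_poly_symmetric:
  fixes A :: "real mat"
  assumes A: "A \<in> carrier_mat n n"
    and sym: "\<And>i j. i < n \<Longrightarrow> j < n \<Longrightarrow> A $$ (i, j) = A $$ (j, i)"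
  shows "size (proots (char_poly A)) = n"
proof -
  interpret map_poly_hom: map_poly_inj_idom_hom complex_of_real ..
  let ?C = "map_mat complex_of_real A"
  have C: "?C \<in> carrier_mat n n"
    using A by simp
  obtain as where as: "char_poly ?C = (\<Prod>a\<leftarrow>as. [:- a, 1:])" and len: "length as = n"
    using char_poly_factorized[OF C] by auto
  have re: "complex_of_real (Re a) = a" if "a \<in> set as" for a
  proof -
    have "poly (char_poly ?C) a = 0"
      unfolding as using that by (induction as) auto
    then have "eigenvalue ?C a"
      using eigenvalue_root_char_poly[OF C] by simp
    from symmetric_real_mat_eigenvalue_real[OF A sym this] show ?thesis
      by (simp add: complex_eq_iff)
  qed
  have "map_poly complex_of_real (char_poly A) = (\<Prod>a\<leftarrow>as. [:- a, 1:])"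
    using as of_real_hom.char_poly_hom[OF A, where ?'a = complex] by simp
  also have "\<dots> = (\<Prod>a\<leftarrow>map (complex_of_real \<circ> Re) as. [:- a, 1:])"
    by (intro arg_cong[of _ _ prod_list]) (use re in auto)
  also have "\<dots> = map_poly complex_of_real (\<Prod>a\<leftarrow>map Re as. [:- a, 1:])"
    by (induction as) (auto simp: map_poly_hom.hom_mult simp del: mult_pCons_left)
  finally have "char_poly A = (\<Prod>a\<leftarrow>map Re as. [:- a, 1:])"
    by (metis map_poly_hom.injectivity)
  moreover have "size (proots (\<Prod>a\<leftarrow>bs. [:- a, 1:] :: real poly)) = length bs" for bs :: "real list"
  proof (induction bs)
    case (Cons b bs)
    have "(\<Prod>a\<leftarrow>bs. [:- a, 1:] :: real poly) \<noteq> 0"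
      by (auto simp: prod_list_zero_iff)
    with Cons show ?case
      by (simp add: proots_mult del: mult_pCons_left)
  qed simp
  ultimately show ?thesis
    using len by (metis length_map)
qed

lemma size_laplacian_eigenvalues:
  assumes "graph G"
  shows "size (laplacian_eigenvalues G) = card (verts G)"
proof -
  interpret graph G by fact
  obtain xs where xs: "distinct xs" "set xs = verts G"
    using finite_distinct_list[OF finite_verts] by blast
  have "laplacian_mat G xs \<in> carrier_mat (length xs) (length xs)"
    by (auto simp: laplacian_mat_def degree_mat_def adjacency_mat_def)
  moreover have "laplacian_mat G xs $$ (i, j) = laplacian_mat G xs $$ (j, i)"
    if "i < length xs" "j < length xs" for i j
    using that arcs_ends_symmetric[OF sym_arcs]
    by (auto simp: laplacian_mat_def degree_mat_def adjacency_mat_def)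
  ultimately show ?thesis
    using size_proots_char_poly_symmetric laplacian_eigenvalues_eq[OF xs] xs
    by (metis distinct_card)
qed

end

theory Submission
  imports Defs
begin

text \<open>
  The diagonal of a real symmetric matrix is a doubly stochastic image of its spectrum, hence
  \<open>LE(G) \<ge> \<Sum>\<^sub>v \<bar>d(v) - d\<bar>\<close>, where \<open>d\<close> is the average degree. Estimating \<open>\<bar>d(v) - d\<bar>\<close> by \<open>d(v) - d\<close>
  at the internal and by \<open>d - d(v)\<close> at the pendent vertices, and using that a connected graph has at least \<open>n - 1\<close>
  edges, gives \<open>LE(T) \<ge> 2 (n - s - 2 + 2 s / n)\<close>, which is at least \<open>4 n / \<pi>\<close> by hypothesis. On the other
  hand \<open>P\<^sub>n\<close> has the eigenvalues \<open>2 - 2 cos (\<pi> j / n)\<close>, so that \<open>LE(P\<^sub>n)\<close> is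
  \<open>2 cot (\<pi> / 2n)\<close> for even \<open>n\<close> and \<open>2 / sin (\<pi> / 2n) - 2 / n\<close> for odd \<open>n\<close>; both are at most \<open>4 n / \<pi>\<close>.
\<close>

subsection \<open>Diagonalization of real symmetric matrices\<close>

text \<open>\<open>H\<close> is the reflection in the hyperplane orthogonal to
  \<open>v - unit_vec n 0\<close>, which exchanges these two unit vectors. If they coincide there is
  no such hyperplane, and the identity serves instead.\<close>

lemma householder:
  fixes v :: "real vec"
  assumes v: "v \<in> carrier_vec n" "v \<bullet> v = 1" and n: "0 < n"
  obtains H :: "real mat" where "H \<in> carrier_mat n n" "H\<^sup>T = H" "H * H = 1\<^sub>m n"
    "H *\<^sub>v v = unit_vec n 0"
proof (cases "v = unit_vec n 0")
  case True
  then show ?thesis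
    using v by (intro that[of "1\<^sub>m n"]) auto
next
  case False
  define w where "w i = v $ i - (if i = 0 then 1 else 0)" for i
  have vv: "(\<Sum>i<n. v $ i * v $ i) = 1"
    using v by (simp add: scalar_prod_def atLeast0LessThan)
  have delta: "(\<Sum>i<n. (if i = 0 then 1 else 0) * f i) = f 0" for f :: "nat \<Rightarrow> real"
    using n by (simp add: if_distrib[of "\<lambda>x. x * _"] sum.delta cong: if_cong)
  have wv: "(\<Sum>i<n. w i * v $ i) = 1 - v $ 0"
    using vv by (simp add: w_def left_diff_distrib sum_subtractf delta)
  have w0: "(\<Sum>i<n. w i * (if i = 0 then 1 else 0)) = v $ 0 - 1"
    using delta[of w] by (simp add: mult.commute w_def)
  have "(\<Sum>i<n. w i * w i) = (\<Sum>i<n. w i * v $ i - w i * (if i = 0 then 1 else 0))"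
    by (simp add: w_def[of _] algebra_simps)
  then have ww: "(\<Sum>i<n. w i * w i) = 2 * (1 - v $ 0)"
    by (simp add: sum_subtractf wv w0)
  have "1 - v $ 0 \<noteq> 0"
  proof
    assume "1 - v $ 0 = 0"
    with ww have "(\<Sum>i<n. w i * w i) = 0"
      by simp
    then have "\<forall>i\<in>{..<n}. w i * w i = 0"
      by (subst (asm) sum_nonneg_eq_0_iff) auto
    then have "v = unit_vec n 0"
      using v(1) n by (intro eq_vecI) (auto simp: w_def unit_vec_def)
    with False show False ..
  qed
  \<comment> \<open>By \<open>ww\<close> this \<open>c\<close> is 2 divided by the squared length of
    \<open>w\<close>, the usual factor in a reflection.\<close>
  then obtain c where c: "c * (1 - v $ 0) = 1"
    by (metis right_inverse mult.commute)
  define H where "H = mat n n (\<lambda>(i, j). (if i = j then 1 else 0) - c * w i * w j)"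
  have "H * H = 1\<^sub>m n"
  proof (rule eq_matI)
    fix i j assume ij: "i < dim_row (1\<^sub>m n :: real mat)" "j < dim_col (1\<^sub>m n :: real mat)"
    then have "(H * H) $$ (i, j) =
        (\<Sum>k<n. ((if i = k then 1 else 0) - c * w i * w k) * ((if k = j then 1 else 0) - c * w k * w j))"
      by (simp add: H_def scalar_prod_def atLeast0LessThan)
    also have "\<dots> = (\<Sum>k<n. (if i = k then if k = j then 1 else 0 else 0)
        - (if i = k then c * w k * w j else 0) - (if k = j then c * w i * w k else 0)
        + c * c * w i * w j * (w k * w k))"
      by (intro sum.cong refl) (simp add: algebra_simps)
    also have "\<dots> = (if i = j then 1 else 0) - c * w i * w j - c * w i * w j
        + c * w i * w j * (2 * (c * (1 - v $ 0)))"
      using ij by (simp add: sum.distrib sum_subtractf sum_distrib_left[symmetric] ww)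
    also have "\<dots> = (if i = j then 1 else 0)"
      by (simp add: c)
    finally show "(H * H) $$ (i, j) = 1\<^sub>m n $$ (i, j)"
      using ij by simp
  qed (auto simp: H_def)
  moreover have "H *\<^sub>v v = unit_vec n 0"
  proof (rule eq_vecI)
    fix i assume i: "i < dim_vec (unit_vec n 0 :: real vec)"
    then have "(H *\<^sub>v v) $ i = (\<Sum>k<n. ((if i = k then 1 else 0) - c * w i * w k) * v $ k)"
      using v by (simp add: H_def scalar_prod_def atLeast0LessThan)
    also have "\<dots> = (\<Sum>k<n. (if i = k then v $ k else 0) - c * w i * (w k * v $ k))"
      by (intro sum.cong refl) (simp add: algebra_simps)
    also have "\<dots> = v $ i - w i * (c * (1 - v $ 0))"
      using i by (simp add: sum_subtractf sum_distrib_left[symmetric] wv)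
    also have "\<dots> = unit_vec n 0 $ i"
      using i n by (simp add: c w_def)
    finally show "(H *\<^sub>v v) $ i = unit_vec n 0 $ i" .
  qed (simp add: H_def)
  moreover have "H\<^sup>T = H"
    by (rule eq_matI) (auto simp: H_def)
  moreover have "H \<in> carrier_mat n n"
    by (simp add: H_def)
  ultimately show ?thesis
    using that by blast
qed

text \<open>The characteristic polynomial of a real symmetric matrix has \<open>n\<close> real roots
  with multiplicity, so for \<open>n > 0\<close> there is a real eigenvalue; an eigenvector is then
  rescaled to length 1.\<close>

lemma symmetric_mat_unit_eigenvector:
  fixes A :: "real mat"
  assumes A: "A \<in> carrier_mat n n" "A\<^sup>T = A" and n: "0 < n"
  obtains v e where "v \<in> carrier_vec n" "v \<bullet> v = 1" "A *\<^sub>v v = e \<cdot>\<^sub>v v"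
proof -
  have "A $$ (i, j) = A $$ (j, i)" if "i < n" "j < n" for i j
    using A that by (metis index_transpose_mat(1) carrier_matD)
  then have "proots (char_poly A) \<noteq> {#}"
    using size_proots_char_poly_symmetric[OF A(1)] n by fastforce
  then obtain e where "e \<in># proots (char_poly A)"
    by blast
  then have "poly (char_poly A) e = 0"
    by (cases "char_poly A = 0") auto
  then obtain v where v: "v \<in> carrier_vec n" "v \<noteq> 0\<^sub>v n" "A *\<^sub>v v = e \<cdot>\<^sub>v v"
    using eigenvalue_root_char_poly[OF A(1)] A(1) by (auto simp: eigenvalue_def eigenvector_def)
  have "v \<bullet> v = (\<Sum>i<n. (v $ i)\<^sup>2)"
    using v(1) by (simp add: scalar_prod_def atLeast0LessThan power2_eq_square)
  moreover have "(\<Sum>i<n. (v $ i)\<^sup>2) \<noteq> 0"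
  proof
    assume "(\<Sum>i<n. (v $ i)\<^sup>2) = 0"
    then have "\<forall>i\<in>{..<n}. (v $ i)\<^sup>2 = 0"
      by (subst (asm) sum_nonneg_eq_0_iff) auto
    then have "v = 0\<^sub>v n"
      using v(1) by (intro eq_vecI) auto
    with v(2) show False ..
  qed
  ultimately have pos: "v \<bullet> v > 0"
    by (metis sum_nonneg zero_le_power2 less_le)
  define c where "c = 1 / sqrt (v \<bullet> v)"
  have "(c \<cdot>\<^sub>v v) \<bullet> (c \<cdot>\<^sub>v v) = c * c * (v \<bullet> v)"
    using v(1) by (simp add: smult_scalar_prod_distrib[of _ n] scalar_prod_smult_distrib[of _ n])
  also have "\<dots> = 1"
    using pos by (simp add: c_def field_simps)
  finally show ?thesis
    using v A(1) by (intro that[of "c \<cdot>\<^sub>v v" e]) (auto simp: mult_mat_vec smult_smult_assoc mult.commute)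
qed

text \<open>Deflation: conjugating by a Householder reflection moves a unit eigenvector to the first
  basis vector. By symmetry the first row and column of the conjugate \<open>B\<close> then vanish
  off the diagonal, and the induction hypothesis applies to the remaining block
  \<open>C\<close>.\<close>

lemma symmetric_mat_diagonalizable:
  fixes A :: "real mat"
  assumes "A \<in> carrier_mat n n" "A\<^sup>T = A"
  shows "\<exists>U D. U \<in> carrier_mat n n \<and> D \<in> carrier_mat n n \<and> diagonal_mat D \<and>
    U * U\<^sup>T = 1\<^sub>m n \<and> A = U * D * U\<^sup>T"
  using assms
proof (induction n arbitrary: A)
  case 0
  then show ?case
    by (intro exI[of _ "1\<^sub>m 0"]) (auto simp: diagonal_mat_def)
next
  case (Suc n)
  let ?N = "Suc n"
  note A = Suc.prems
  obtain v e where v: "v \<in> carrier_vec ?N" "v \<bullet> v = 1" "A *\<^sub>v v = e \<cdot>\<^sub>v v"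
    using symmetric_mat_unit_eigenvector[OF A] by blast
  obtain H where H: "H \<in> carrier_mat ?N ?N" "H\<^sup>T = H" "H * H = 1\<^sub>m ?N" "H *\<^sub>v v = unit_vec ?N 0"
    using householder[OF v(1,2)] by blast
  note assoc = assoc_mult_mat[of _ ?N ?N _ ?N _ ?N]
  define B where "B = H * A * H"
  have B: "B \<in> carrier_mat ?N ?N"
    using H A by (simp add: B_def)
  have BT: "B\<^sup>T = B"
    using H A by (simp add: B_def transpose_mult[of _ ?N ?N _ ?N] assoc)
  \<comment> \<open>As an involution, \<open>H\<close> also maps the first basis vector back to
    \<open>v\<close>, where \<open>A\<close> acts as the scalar \<open>e\<close>.\<close>
  have Be: "B *\<^sub>v unit_vec ?N 0 = e \<cdot>\<^sub>v unit_vec ?N 0"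
  proof -
    have "H *\<^sub>v unit_vec ?N 0 = (H * H) *\<^sub>v v"
      using H v by (metis assoc_mult_mat_vec)
    then have "H *\<^sub>v unit_vec ?N 0 = v"
      using H v by simp
    moreover have "B *\<^sub>v unit_vec ?N 0 = H *\<^sub>v (A *\<^sub>v (H *\<^sub>v unit_vec ?N 0))"
      unfolding B_def using H A by (simp add: assoc_mult_mat_vec[of _ ?N ?N _ ?N])
    ultimately show ?thesis
      using H v by (simp add: mult_mat_vec)
  qed
  have B0: "B $$ (i, 0) = (if i = 0 then e else 0)" if "i < ?N" for i
  proof -
    have "B $$ (i, 0) = (B *\<^sub>v unit_vec ?N 0) $ i"
      using B that by simp
    also have "\<dots> = (if i = 0 then e else 0)"
      using that by (simp only: Be) simp
    finally show ?thesis .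
  qed
  have B0': "B $$ (0, i) = (if i = 0 then e else 0)" if "i < ?N" for i
    using B0[OF that] BT B that by (metis index_transpose_mat(1) carrier_matD zero_less_Suc)
  define C where "C = mat n n (\<lambda>(i, j). B $$ (Suc i, Suc j))"
  have C: "C \<in> carrier_mat n n"
    by (simp add: C_def)
  have "C\<^sup>T = C"
    using BT B by (intro eq_matI) (auto simp: C_def, metis index_transpose_mat(1) carrier_matD Suc_less_eq)
  from Suc.IH[OF C this] obtain V D where V: "V \<in> carrier_mat n n" "V * V\<^sup>T = 1\<^sub>m n"
    and D: "D \<in> carrier_mat n n" "diagonal_mat D" and CV: "C = V * D * V\<^sup>T"
    by blast
  let ?E = "mat 1 1 (\<lambda>_. e)"
  let ?W = "four_block_mat (1\<^sub>m 1) (0\<^sub>m 1 n) (0\<^sub>m n 1) V"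
  let ?D = "four_block_mat ?E (0\<^sub>m 1 n) (0\<^sub>m n 1) D"
  have W: "?W \<in> carrier_mat ?N ?N" and D': "?D \<in> carrier_mat ?N ?N"
    using four_block_carrier_mat[of "1\<^sub>m 1" 1 1 V n n] four_block_carrier_mat[of ?E 1 1 D n n] V D
    by auto
  have WT: "?W\<^sup>T = four_block_mat (1\<^sub>m 1) (0\<^sub>m 1 n) (0\<^sub>m n 1) (V\<^sup>T)"
    using V by (subst transpose_four_block_mat[of _ 1 1 _ n _ n]) auto
  have WW: "?W * ?W\<^sup>T = 1\<^sub>m ?N"
    unfolding WT using V
    by (subst mult_four_block_mat[of _ 1 1 _ n _ n _ _ 1 _ n]) auto
  have "B = four_block_mat ?E (0\<^sub>m 1 n) (0\<^sub>m n 1) C"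
    using B by (intro eq_matI) (auto simp: B0 B0' C_def)
  also have "\<dots> = ?W * ?D * ?W\<^sup>T"
    unfolding WT CV using V D
    by (simp add: mult_four_block_mat[of _ 1 1 _ n _ n _ _ 1 _ n])
  finally have BW: "B = ?W * ?D * ?W\<^sup>T" .
  have U: "H * ?W \<in> carrier_mat ?N ?N"
    using H W by simp
  have UT: "(H * ?W)\<^sup>T = ?W\<^sup>T * H"
    using H W by (simp add: transpose_mult[of _ ?N ?N _ ?N])
  have W': "?W\<^sup>T \<in> carrier_mat ?N ?N"
    using W by simp
  have "(H * ?W) * (H * ?W)\<^sup>T = H * (?W * ?W\<^sup>T) * H"
    unfolding UT using H(1) W W' by (simp add: assoc)
  also have "\<dots> = 1\<^sub>m ?N"
    unfolding WW using H by simp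
  finally have UU: "(H * ?W) * (H * ?W)\<^sup>T = 1\<^sub>m ?N" .
  have "H * B * H = (H * H) * A * (H * H)"
    unfolding B_def using H(1) A(1) by (simp add: assoc)
  then have "A = H * B * H"
    using H A by simp
  also have "\<dots> = (H * ?W) * ?D * (H * ?W)\<^sup>T"
    unfolding UT BW using H(1) W W' D' by (simp add: assoc)
  finally have "A = (H * ?W) * ?D * (H * ?W)\<^sup>T" .
  moreover have "diagonal_mat ?D"
    using D by (auto simp: diagonal_mat_def)
  ultimately show ?case
    using U D' UU by blast
qed

text \<open>Orthogonality makes the squared entries of \<open>U\<close> a doubly stochastic matrix
  \<open>P\<close>. Row sums 1 turn each diagonal entry into a convex combination of eigenvalues, so
  the triangle inequality applies after subtracting \<open>t\<close>; column sums 1 collapse the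
  resulting double sum.\<close>

lemma sum_abs_diagonal_le_sum_abs_eigenvalues:
  fixes A :: "real mat"
  assumes A: "A \<in> carrier_mat n n" "A\<^sup>T = A"
  shows "(\<Sum>i<n. \<bar>A $$ (i, i) - t\<bar>) \<le> (\<Sum>\<mu>\<in>#proots (char_poly A). \<bar>\<mu> - t\<bar>)"
proof -
  obtain U D where U: "U \<in> carrier_mat n n" "U * U\<^sup>T = 1\<^sub>m n"
    and D: "D \<in> carrier_mat n n" "diagonal_mat D" and AU: "A = U * D * U\<^sup>T"
    using symmetric_mat_diagonalizable[OF A] by blast
  have UT: "U\<^sup>T \<in> carrier_mat n n" using U by simp
  have U': "U\<^sup>T * U = 1\<^sub>m n"
    by (rule mat_mult_left_right_inverse[OF U(1) UT U(2)])
  have "similar_mat A D"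
    by (rule similar_matI[of _ _ U "U\<^sup>T" n]) (use A U UT U' D AU in auto)
  then have "char_poly A = char_poly D"
    by (rule char_poly_similar)
  also have "\<dots> = (\<Prod>a\<leftarrow>diag_mat D. [:- a, 1:])"
    by (rule char_poly_upper_triangular[OF D(1)]) (use D in \<open>auto simp: diagonal_mat_def\<close>)
  finally have "char_poly A = (\<Prod>a\<leftarrow>diag_mat D. [:- a, 1:])" .
  moreover have "proots (\<Prod>a\<leftarrow>as. [:- a, 1:]) = mset as" for as :: "real list"
  proof (induction as)
    case (Cons a as)
    have "(\<Prod>a\<leftarrow>as. [:- a, 1:] :: real poly) \<noteq> 0"
      by (auto simp: prod_list_zero_iff)
    with Cons show ?case
      by (simp add: proots_mult del: mult_pCons_left)
  qed simp
  ultimately have "proots (char_poly A) = mset (diag_mat D)"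
    by simp
  also have "\<dots> = image_mset (\<lambda>i. D $$ (i, i)) (mset_set {..<n})"
    using D by (simp add: diag_mat_def mset_upt atLeast0LessThan)
  finally have roots: "proots (char_poly A) = image_mset (\<lambda>i. D $$ (i, i)) (mset_set {..<n})" .
  have UD: "(U * D) $$ (i, k) = U $$ (i, k) * D $$ (k, k)" if "i < n" "k < n" for i k
  proof -
    have "(U * D) $$ (i, k) = (\<Sum>l<n. U $$ (i, l) * D $$ (l, k))"
      using that U D by (simp add: scalar_prod_def atLeast0LessThan)
    also have "\<dots> = (\<Sum>l<n. if l = k then U $$ (i, k) * D $$ (k, k) else 0)"
      using D that by (intro sum.cong) (auto simp: diagonal_mat_def)
    finally show ?thesis
      using that by simp
  qed
  define P where "P i k = (U $$ (i, k))\<^sup>2" for i k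
  define d where "d k = D $$ (k, k)" for k
  have nonneg: "P i k \<ge> 0" for i k
    by (simp add: P_def)
  have row: "(\<Sum>k<n. P i k) = 1" if i: "i < n" for i
  proof -
    have "(U * U\<^sup>T) $$ (i, i) = (\<Sum>k<n. P i k)"
      using U(1) i by (simp add: P_def scalar_prod_def atLeast0LessThan power2_eq_square)
    then show ?thesis
      using U(2) i by simp
  qed
  have col: "(\<Sum>i<n. P i k) = 1" if k: "k < n" for k
  proof -
    have "(U\<^sup>T * U) $$ (k, k) = (\<Sum>i<n. P i k)"
      using U(1) k by (simp add: P_def scalar_prod_def atLeast0LessThan power2_eq_square)
    then show ?thesis
      using U' k by simp
  qed
  have diag: "A $$ (i, i) = (\<Sum>k<n. P i k * d k)" if i: "i < n" for i
  proof -
    have *: "(M * U\<^sup>T) $$ (i, i) = (\<Sum>k<n. M $$ (i, k) * U $$ (i, k))" if "M \<in> carrier_mat n n" for M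
      using that U(1) i by (simp add: scalar_prod_def atLeast0LessThan)
    have "A $$ (i, i) = (\<Sum>k<n. (U * D) $$ (i, k) * U $$ (i, k))"
      unfolding AU by (rule *) (use U(1) D(1) in simp)
    also have "\<dots> = (\<Sum>k<n. P i k * d k)"
      using i by (intro sum.cong) (simp_all add: UD P_def d_def power2_eq_square del: index_mult_mat)
    finally show ?thesis .
  qed
  have "\<bar>A $$ (i, i) - t\<bar> \<le> (\<Sum>k<n. P i k * \<bar>d k - t\<bar>)" if "i < n" for i
  proof -
    have "A $$ (i, i) - t = (\<Sum>k<n. P i k * d k) - (\<Sum>k<n. P i k) * t"
      using that by (simp add: diag row)
    also have "\<dots> = (\<Sum>k<n. P i k * (d k - t))"
      by (simp add: sum_distrib_right sum_subtractf right_diff_distrib)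
    finally show ?thesis
      using sum_abs[of "\<lambda>k. P i k * (d k - t)" "{..<n}"] nonneg by (simp add: abs_mult)
  qed
  then have "(\<Sum>i<n. \<bar>A $$ (i, i) - t\<bar>) \<le> (\<Sum>i<n. \<Sum>k<n. P i k * \<bar>d k - t\<bar>)"
    by (intro sum_mono) auto
  also have "\<dots> = (\<Sum>k<n. \<Sum>i<n. P i k * \<bar>d k - t\<bar>)"
    by (rule sum.swap)
  also have "\<dots> = (\<Sum>k<n. \<bar>d k - t\<bar>)"
    by (simp add: col flip: sum_distrib_right)
  also have "\<dots> = (\<Sum>\<mu>\<in>#proots (char_poly A). \<bar>\<mu> - t\<bar>)"
    by (simp add: roots d_def sum_unfold_sum_mset image_mset.compositionality comp_def)
  finally show ?thesis .
qed

subsection \<open>Degrees, edges and Laplacian eigenvectors\<close>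

lemma laplacian_mat_carrier: "laplacian_mat G xs \<in> carrier_mat (length xs) (length xs)"
  by (auto simp: laplacian_mat_def degree_mat_def adjacency_mat_def)

lemma laplacian_mat_index:
  assumes "i < length xs" "j < length xs"
  shows "laplacian_mat G xs $$ (i, j) =
    (if i = j then real (out_degree G (xs ! i)) else 0) - (if xs ! i \<rightarrow>\<^bsub>G\<^esub> xs ! j then 1 else 0)"
  using assms by (simp add: laplacian_mat_def degree_mat_def adjacency_mat_def)

context graph
begin

lemma card_arcs_ends: "card (arcs_ends G) = card (arcs G)"
  unfolding arcs_ends_def by (rule card_image[OF inj_on_arc_to_ends])

lemma finite_arcs_ends: "finite (arcs_ends G)"
  unfolding arcs_ends_def by simp

lemma edges_conv_image: "edges G = (\<lambda>(u, v). {u, v}) ` arcs_ends G"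
  by (auto simp: edges_def)

lemma finite_edges: "finite (edges G)"
  by (simp add: edges_conv_image finite_arcs_ends)

text \<open>Without parallel arcs an arc leaving \<open>v\<close> is determined by its head, so arcs
  may be traded for neighbours.\<close>

lemma out_degree_conv: "out_degree G v = card {u \<in> verts G. v \<rightarrow>\<^bsub>G\<^esub> u}"
proof -
  have "{u \<in> verts G. v \<rightarrow>\<^bsub>G\<^esub> u} = head G ` out_arcs G v"
    by (auto simp: arcs_ends_conv)
  moreover have "inj_on (head G) (out_arcs G v)"
    by (rule inj_onI) (auto simp: arc_to_ends_def intro: no_multi_arcs)
  ultimately show ?thesis
    by (simp add: out_degree_def card_image)
qed

lemma sum_out_degree: "(\<Sum>v\<in>verts G. out_degree G v) = card (arcs G)"
proof -
  have "(\<Sum>v\<in>verts G. out_degree G v) = card (\<Union>v\<in>verts G. out_arcs G v)"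
    unfolding out_degree_def by (rule card_UN_disjoint[symmetric]) auto
  also have "(\<Union>v\<in>verts G. out_arcs G v) = arcs G"
    by auto
  finally show ?thesis .
qed

text \<open>Forgetting the direction of an arc is a two-to-one map onto the edges: symmetry supplies
  both orientations, and the absence of loops keeps them distinct.\<close>

lemma card_arcs_eq_twice_edges: "card (arcs G) = 2 * card (edges G)"
proof -
  let ?g = "\<lambda>(u, v). {u, v}"
  have fibre: "card {p \<in> arcs_ends G. ?g p = e} = 2" if edge: "e \<in> edges G" for e
  proof -
    obtain u v where e: "e = {u, v}" "u \<rightarrow>\<^bsub>G\<^esub> v"
      using edge unfolding edges_def by blast
    then have "v \<rightarrow>\<^bsub>G\<^esub> u" "u \<noteq> v"
      using arcs_ends_symmetric[OF sym_arcs] adj_not_same by auto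
    then have "{p \<in> arcs_ends G. ?g p = e} = {(u, v), (v, u)}"
      using e by (auto simp: doubleton_eq_iff)
    then show ?thesis
      using \<open>u \<noteq> v\<close> by simp
  qed
  have "card (arcs_ends G) = (\<Sum>e\<in>?g ` arcs_ends G. \<Sum>p\<in>{p \<in> arcs_ends G. ?g p = e}. 1)"
    using sum.image_gen[OF finite_arcs_ends, of "\<lambda>_. 1::nat" ?g] by simp
  also have "\<dots> = (\<Sum>e\<in>edges G. 2)"
    unfolding edges_conv_image[symmetric] by (intro sum.cong) (simp_all add: fibre)
  finally show ?thesis
    by (simp add: card_arcs_ends)
qed

lemma handshake: "(\<Sum>v\<in>verts G. out_degree G v) = 2 * card (edges G)"
  by (simp add: sum_out_degree card_arcs_eq_twice_edges)

text \<open>Mapping each vertex other than a root \<open>r\<close> to the last edge of a shortest walk from \<open>r\<close> is injective.\<close>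

lemma connected_card_verts_le:
  assumes "Digraph_Component.connected G"
  shows "card (verts G) \<le> card (edges G) + 1"
proof -
  have "strongly_connected G"
    by (rule symmetric_connected_imp_strongly_connected[OF sym_arcs assms])
  then obtain r where r: "r \<in> verts G" and reach: "\<And>v. v \<in> verts G \<Longrightarrow> (r, v) \<in> (arcs_ends G)\<^sup>*"
    unfolding strongly_connected_def by (auto dest: reachable_rtranclI)
  define dist where "dist v = (LEAST k. (r, v) \<in> arcs_ends G ^^ k)" for v
  have dist: "(r, v) \<in> arcs_ends G ^^ dist v" if "v \<in> verts G" for v
    unfolding dist_def using reach[OF that] by (metis LeastI rtrancl_power)
  have "\<exists>u. u \<rightarrow>\<^bsub>G\<^esub> v \<and> dist u < dist v" if v: "v \<in> verts G - {r}" for v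
  proof (cases "dist v")
    case 0
    then show ?thesis
      using dist[of v] v by simp
  next
    case (Suc m)
    then obtain u where u: "(r, u) \<in> arcs_ends G ^^ m" "u \<rightarrow>\<^bsub>G\<^esub> v"
      using dist[of v] v by auto
    then have "dist u \<le> m"
      unfolding dist_def by (intro Least_le)
    then show ?thesis
      using u Suc by auto
  qed
  then obtain p where p: "\<And>v. v \<in> verts G - {r} \<Longrightarrow> p v \<rightarrow>\<^bsub>G\<^esub> v \<and> dist (p v) < dist v"
    by metis
  \<comment> \<open>If distinct \<open>v\<close> and \<open>w\<close> gave the same edge, then
    \<open>p v = w\<close> and \<open>p w = v\<close>, so each would be strictly closer to
    \<open>r\<close> than the other.\<close>
  have "inj_on (\<lambda>v. {p v, v}) (verts G - {r})"
    by (rule inj_onI) (metis doubleton_eq_iff not_less_iff_gr_or_eq p)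
  moreover have "(\<lambda>v. {p v, v}) ` (verts G - {r}) \<subseteq> edges G"
    using p by (auto simp: edges_def)
  ultimately have "card (verts G - {r}) \<le> card (edges G)"
    using finite_edges by (rule card_inj_on_le)
  then show ?thesis
    using r by (simp add: card_Diff_singleton)
qed

text \<open>The first step of a walk to some other vertex is an arc leaving \<open>v\<close>. Hence
  a vertex that is not internal has degree exactly 1.\<close>

lemma connected_out_degree_pos:
  assumes "Digraph_Component.connected G" "card (verts G) \<ge> 2" "v \<in> verts G"
  shows "out_degree G v \<ge> 1"
proof -
  have sc: "strongly_connected G"
    by (rule symmetric_connected_imp_strongly_connected[OF sym_arcs assms(1)])
  have "verts G \<noteq> {v}"
    using assms(2) by auto
  then obtain w where w: "w \<in> verts G" "w \<noteq> v"
    using assms(3) by auto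
  then have "(v, w) \<in> (arcs_ends G)\<^sup>*"
    using sc assms(3) unfolding strongly_connected_def by (auto dest: reachable_rtranclI)
  then obtain u where "v \<rightarrow>\<^bsub>G\<^esub> u"
    using w(2) by (auto elim: converse_rtranclE)
  then have "u \<in> {u \<in> verts G. v \<rightarrow>\<^bsub>G\<^esub> u}"
    using adj_in_verts by auto
  then have "{u \<in> verts G. v \<rightarrow>\<^bsub>G\<^esub> u} \<noteq> {}"
    by blast
  then show ?thesis
    unfolding out_degree_conv by (simp add: Suc_le_eq card_gt_0_iff)
qed

lemma transpose_laplacian_mat: "(laplacian_mat G xs)\<^sup>T = laplacian_mat G xs"
  using arcs_ends_symmetric[OF sym_arcs] laplacian_mat_carrier[of G xs]
  by (intro eq_matI) (auto simp: laplacian_mat_index)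

lemma sum_verts_conv_nth:
  assumes "distinct xs" "set xs = verts G"
  shows "(\<Sum>v\<in>verts G. f v) = (\<Sum>i<length xs. f (xs ! i))"
  using sum.reindex_bij_betw[OF bij_betw_nth[OF assms(1) refl refl], of f] assms(2) by simp

text \<open>The eigenvector is a function on the vertices, so that concrete graphs can be treated
  without choosing an enumeration. Only membership results; multiplicities have to come from
  counting.\<close>

lemma laplacian_eigenvaluesI:
  assumes eq: "\<And>v. v \<in> verts G \<Longrightarrow> (\<Sum>u | u \<in> verts G \<and> v \<rightarrow>\<^bsub>G\<^esub> u. w v - w u) = \<mu> * w v"
    and nonzero: "v\<^sub>0 \<in> verts G" "w v\<^sub>0 \<noteq> 0"
  shows "\<mu> \<in># laplacian_eigenvalues G"
proof -
  obtain xs where xs: "distinct xs" "set xs = verts G"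
    using finite_distinct_list[OF finite_verts] by blast
  let ?L = "laplacian_mat G xs" and ?n = "length xs"
  have L: "?L \<in> carrier_mat ?n ?n"
    by (rule laplacian_mat_carrier)
  define x where "x = vec ?n (\<lambda>i. w (xs ! i))"
  have "?L *\<^sub>v x = \<mu> \<cdot>\<^sub>v x"
  proof (rule eq_vecI)
    fix i assume "i < dim_vec (\<mu> \<cdot>\<^sub>v x)"
    then have i: "i < ?n" by (simp add: x_def)
    then have v: "xs ! i \<in> verts G"
      using xs(2) nth_mem by blast
    have "(?L *\<^sub>v x) $ i = (\<Sum>j<?n. ?L $$ (i, j) * w (xs ! j))"
      using i L by (simp add: x_def scalar_prod_def atLeast0LessThan)
    also have "\<dots> = (\<Sum>j<?n. (if i = j then real (out_degree G (xs ! i)) * w (xs ! i) else 0)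
        - (if xs ! i \<rightarrow>\<^bsub>G\<^esub> xs ! j then w (xs ! j) else 0))"
      using i by (intro sum.cong) (auto simp: laplacian_mat_index algebra_simps)
    also have "\<dots> = real (out_degree G (xs ! i)) * w (xs ! i)
        - (\<Sum>u\<in>verts G. if xs ! i \<rightarrow>\<^bsub>G\<^esub> u then w u else 0)"
      using i by (simp add: sum_subtractf sum_verts_conv_nth[OF xs])
    also have "\<dots> = (\<Sum>u | u \<in> verts G \<and> xs ! i \<rightarrow>\<^bsub>G\<^esub> u. w (xs ! i) - w u)"
      by (simp add: sum_subtractf out_degree_conv sum.inter_filter)
    also have "\<dots> = (\<mu> \<cdot>\<^sub>v x) $ i"
      using i eq[OF v] by (simp add: x_def)
    finally show "(?L *\<^sub>v x) $ i = (\<mu> \<cdot>\<^sub>v x) $ i" .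
  qed (use L in \<open>simp add: x_def\<close>)
  moreover have "x \<noteq> 0\<^sub>v ?n"
  proof -
    obtain i where "i < ?n" "xs ! i = v\<^sub>0"
      using nonzero(1) xs(2) by (metis in_set_conv_nth)
    then have "x $ i \<noteq> 0"
      using nonzero(2) by (simp add: x_def)
    with \<open>i < ?n\<close> show ?thesis
      by auto
  qed
  ultimately have "eigenvalue ?L \<mu>"
    using L unfolding eigenvalue_def eigenvector_def by (intro exI[of _ x]) (auto simp: x_def)
  then have "poly (char_poly ?L) \<mu> = 0"
    using eigenvalue_root_char_poly[OF L] by simp
  moreover have "char_poly ?L \<noteq> 0"
    using degree_monic_char_poly[OF L] by (metis coeff_0 zero_neq_one)
  ultimately show ?thesis
    by (simp add: laplacian_eigenvalues_eq[OF xs])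
qed

end

section \<open>The Laplacian spectrum of the path\<close>

lemma path_graph_simps [simp]:
  "verts (path_graph n) = {..<n}"
  "(i, j) \<in> arcs_ends (path_graph n) \<longleftrightarrow> i < n \<and> j < n \<and> (j = Suc i \<or> i = Suc j)"
  by (auto simp: path_graph_def)

lemma card_edges_path_graph: "card (edges (path_graph n)) = n - 1"
proof -
  have "edges (path_graph n) = (\<lambda>i. {i, Suc i}) ` {..<n - 1}"
    by (force simp: edges_def insert_commute)
  moreover have "inj_on (\<lambda>i. {i, Suc i}) {..<n - 1}"
    by (rule inj_onI) (auto simp: doubleton_eq_iff)
  ultimately show ?thesis
    by (simp add: card_image)
qed

text \<open>The eigenvector is \<open>w i = cos ((i + 1/2) * t)\<close> with
  \<open>t = pi * j / n\<close>. The shift by 1/2 makes the cosine symmetric about -1/2, and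
  \<open>n * t = pi * j\<close> makes it symmetric about \<open>n - 1/2\<close>; so the values just
  beyond each end equal the end values, and the end vertices satisfy the same recursion as the inner
  ones.\<close>

lemma path_graph_eigenvalue:
  assumes j: "j < n"
  shows "2 - 2 * cos (pi * real j / real n) \<in># laplacian_eigenvalues (path_graph n)"
proof -
  interpret graph "path_graph n"
    by (rule graph_path_graph)
  define t where "t = pi * real j / real n"
  define w where "w i = cos ((real i + 1 / 2) * t)" for i
  have nt: "real n * t = pi * real j"
    using j by (simp add: t_def)
  have mid: "2 * w (Suc i) - w i - w (Suc (Suc i)) = (2 - 2 * cos t) * w (Suc i)" for i
    using cos_add[of "(real (Suc i) + 1 / 2) * t" t] cos_diff[of "(real (Suc i) + 1 / 2) * t" t]
    by (simp add: w_def algebra_simps)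
  have first: "w 0 - w 1 = (2 - 2 * cos t) * w 0"
    using cos_add[of "t / 2" t] cos_diff[of "t / 2" t] cos_minus[of "t / 2"]
    by (simp add: w_def algebra_simps)
  have wn: "w n = w (n - 1)"
  proof -
    have "w n = cos (pi * real j + t / 2)" "w (n - 1) = cos (pi * real j - t / 2)"
      using j by (simp_all add: w_def of_nat_diff nt[symmetric] algebra_simps)
    then show ?thesis
      by (simp add: cos_add cos_diff)
  qed
  have "(\<Sum>u | u \<in> verts (path_graph n) \<and> i \<rightarrow>\<^bsub>path_graph n\<^esub> u. w i - w u) = (2 - 2 * cos t) * w i"
    if i: "i \<in> verts (path_graph n)" for i
  proof (cases i)
    case 0
    show ?thesis
    \<comment> \<open>A single vertex is both ends at once and has no neighbour: the sum is empty,
      and \<open>first\<close> with \<open>wn\<close> gives zero on the right.\<close>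
    proof (cases "n = 1")
      case True
      then show ?thesis using 0 first wn by simp
    next
      case False
      then have "{u. u \<in> verts (path_graph n) \<and> i \<rightarrow>\<^bsub>path_graph n\<^esub> u} = {1}"
        using 0 i by auto
      then show ?thesis using 0 first by simp
    qed
  next
    case (Suc k)
    show ?thesis
    proof (cases "Suc i = n")
      case True
      then have "{u. u \<in> verts (path_graph n) \<and> i \<rightarrow>\<^bsub>path_graph n\<^esub> u} = {k}"
        using Suc i by auto
      moreover have "w (Suc (Suc k)) = w (Suc k)"
        using wn unfolding True[symmetric] Suc by simp
      ultimately show ?thesis
        using mid[of k] by (simp add: Suc)
    next
      case False
      then have "{u. u \<in> verts (path_graph n) \<and> i \<rightarrow>\<^bsub>path_graph n\<^esub> u} = {k, Suc (Suc k)}"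
        using Suc i by auto
      then show ?thesis using Suc mid[of k] by simp
    qed
  qed
  moreover have "w 0 \<noteq> 0"
  proof -
    have "t < pi"
      using j by (simp add: t_def divide_less_eq)
    moreover have "0 \<le> t"
      by (simp add: t_def)
    ultimately have "0 < cos (t / 2)"
      by (intro cos_gt_zero_pi) auto
    then show ?thesis
      by (simp add: w_def)
  qed
  ultimately show ?thesis
    using j laplacian_eigenvaluesI[of w "2 - 2 * cos t" 0] by (simp add: t_def)
qed

text \<open>Cosine is injective on [0, pi], so the known eigenvalues are \<open>n\<close> distinct
  members of a multiset of size \<open>n\<close> and therefore exhaust it, each with multiplicity
  1.\<close>

lemma laplacian_eigenvalues_path_graph:
  "laplacian_eigenvalues (path_graph n) =
    image_mset (\<lambda>j. 2 - 2 * cos (pi * real j / real n)) (mset_set {..<n})"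
proof -
  let ?f = "\<lambda>j. 2 - 2 * cos (pi * real j / real n)" and ?E = "laplacian_eigenvalues (path_graph n)"
  have inj: "inj_on ?f {..<n}"
  proof (rule inj_onI)
    fix i j assume ij: "i \<in> {..<n}" "j \<in> {..<n}" "?f i = ?f j"
    have "0 \<le> pi * real k / real n" "pi * real k / real n \<le> pi" if "k < n" for k
      using that by (simp_all add: pos_divide_le_eq)
    with ij have "pi * real i / real n = pi * real j / real n"
      using cos_inj_pi[of "pi * real i / real n" "pi * real j / real n"] by simp
    then show "i = j"
      using ij(1) by (simp add: divide_cancel_right)
  qed
  then have f: "image_mset ?f (mset_set {..<n}) = mset_set (?f ` {..<n})"
    by (rule image_mset_mset_set)
  have "?f ` {..<n} \<subseteq> set_mset ?E"
    using path_graph_eigenvalue by auto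
  then have "mset_set (?f ` {..<n}) \<subseteq># mset_set (set_mset ?E)"
    by (simp add: subset_imp_msubset_mset_set)
  then have "mset_set (?f ` {..<n}) \<subseteq># ?E"
    using mset_set_set_mset_msubset subset_mset.order_trans by blast
  moreover have "size (mset_set (?f ` {..<n})) = size ?E"
    using size_laplacian_eigenvalues[OF graph_path_graph, of n] card_image[OF inj] by simp
  ultimately show ?thesis
    unfolding f by (metis mset_subset_size less_irrefl subset_mset.le_imp_less_or_eq)
qed

lemma laplacian_energy_path_graph:
  assumes "n > 0"
  shows "laplacian_energy (path_graph n) = (\<Sum>j<n. \<bar>2 * cos (pi * real j / real n) - 2 / real n\<bar>)"
proof -
  have avg: "average_degree (path_graph n) = 2 - 2 / real n"
    using assms by (simp add: average_degree_def card_edges_path_graph of_nat_diff field_simps)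
  have "laplacian_energy (path_graph n) =
      (\<Sum>j<n. \<bar>2 - 2 * cos (pi * real j / real n) - (2 - 2 / real n)\<bar>)"
    unfolding laplacian_energy_def laplacian_eigenvalues_path_graph avg
    by (simp add: image_mset.compositionality comp_def sum_unfold_sum_mset)
  also have "\<dots> = (\<Sum>j<n. \<bar>2 * cos (pi * real j / real n) - 2 / real n\<bar>)"
    by (intro sum.cong refl) linarith
  finally show ?thesis .
qed

subsection \<open>The energy of the path\<close>

text \<open>Halving the angle, sin x = 2 sin (x/2) cos (x/2) >= x cos^2 (x/2) = x (1 - sin^2 (x/2)),
  using y cos y <= sin y at y = x/2; then sin y <= y finishes. The constant 1/4 is weaker than the
  1/6 of the Taylor bound but sharp enough for the estimates below.\<close>

lemma sin_ge_cubic: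
  fixes x :: real
  assumes "0 \<le> x" "x \<le> pi / 2"
  shows "x * (1 - x\<^sup>2 / 4) \<le> sin x"
proof -
  have sin_ge: "y * cos y \<le> sin y" if "0 \<le> y" "y \<le> pi" for y :: real
  proof -
    have "(\<lambda>t. sin t - t * cos t) 0 \<le> (\<lambda>t. sin t - t * cos t) y"
    proof (rule DERIV_nonneg_imp_nondecreasing[OF that(1)])
      fix t assume t: "0 \<le> t" "t \<le> y"
      have "((\<lambda>t. sin t - t * cos t) has_real_derivative t * sin t) (at t)"
        by (auto intro!: derivative_eq_intros)
      moreover have "0 \<le> t * sin t"
        using t that by (simp add: sin_ge_zero)
      ultimately show "\<exists>z. ((\<lambda>t. sin t - t * cos t) has_real_derivative z) (at t) \<and> 0 \<le> z"
        by blast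
    qed
    then show ?thesis by simp
  qed
  have half: "x / 2 * cos (x / 2) \<le> sin (x / 2)"
    using assms by (intro sin_ge) auto
  have c: "0 \<le> cos (x / 2)"
    using assms by (intro cos_ge_zero) auto
  have "(sin (x / 2))\<^sup>2 \<le> (x / 2)\<^sup>2"
    using assms sin_x_le_x[of "x / 2"] by (intro power_mono) (auto intro: sin_ge_zero)
  then have "1 - x\<^sup>2 / 4 \<le> (cos (x / 2))\<^sup>2"
    by (simp add: cos_squared_eq power_divide)
  then have "x * (1 - x\<^sup>2 / 4) \<le> x * (cos (x / 2))\<^sup>2"
    using assms by (intro mult_left_mono) auto
  also have "\<dots> = 2 * (x / 2 * cos (x / 2)) * cos (x / 2)"
    by (simp add: power2_eq_square)
  also have "\<dots> \<le> 2 * sin (x / 2) * cos (x / 2)"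
    using half c by (intro mult_right_mono) auto
  also have "\<dots> = sin x"
    using sin_double[of "x / 2"] by simp
  finally show ?thesis .
qed

text \<open>Sine takes the value 1/2 at pi/6, and sin x <= x there.\<close>

lemma pi_ge_3: "3 \<le> pi"
  using sin_x_le_x[of "pi / 6"] by (simp add: sin_30)

text \<open>After multiplication by 2 sin t the sum telescopes, because 2 sin t cos (2kt) = sin ((2k
  + 1) t) - sin ((2k - 1) t).\<close>

lemma sum_cos_Dirichlet:
  fixes t :: real
  assumes "sin t \<noteq> 0"
  shows "(\<Sum>j<k. cos (2 * real j * t)) = 1 / 2 + sin ((2 * real k - 1) * t) / (2 * sin t)"
proof (induction k)
  case 0
  then show ?case using assms by (simp add: field_simps)
next
  case (Suc k)
  have "sin ((2 * real (Suc k) - 1) * t) = sin ((2 * real k - 1) * t) + 2 * sin t * cos (2 * real k * t)"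
    using sin_add[of "2 * real k * t" t] sin_diff[of "2 * real k * t" t] by (simp add: algebra_simps)
  then show ?case
    using Suc assms by (simp add: field_simps)
qed

text \<open>The terms are decreasing in \<open>j\<close> and sum to zero: the sum of their absolute values is
  twice the sum over the first \<open>K\<close> of them, which are the nonnegative ones.\<close>

lemma sum_abs_path_eigenvalues_le:
  fixes n :: nat
  assumes n: "n \<ge> 4"
  shows "(\<Sum>j<n. \<bar>2 * cos (pi * real j / real n) - 2 / real n\<bar>) \<le> 4 * real n / pi"
proof -
  \<comment> \<open>In terms of \<open>x\<close> the angles are \<open>2 * j * x\<close>, a right
    angle is \<open>n * x\<close>, and the bound to be proved is \<open>2 / x\<close>.\<close>
  define x where "x = pi / (2 * real n)"
  define a where "a j = 2 * cos (pi * real j / real n) - 2 / real n" for j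
  define K where "K = (n + 1) div 2"
  have nx: "real n = pi / (2 * x)" and x0: "0 < x"
    using n by (auto simp: x_def)
  have x12: "x < 1 / 2"
    using n pi_half_less_two by (simp add: x_def field_simps)
  have "x\<^sup>2 \<le> (1 / 2)\<^sup>2"
    using x0 x12 by (intro power_mono) auto
  then have x2: "15 / 16 \<le> 1 - x\<^sup>2 / 4"
    by (simp add: power_divide)
  have xpi: "x \<le> pi / 2"
    using x12 pi_ge_3 by linarith
  have sin1: "x * (1 - x\<^sup>2 / 4) \<le> sin x"
    using sin_ge_cubic[of x] x0 xpi by simp
  have sin0: "0 < sin x"
    using x0 xpi by (intro sin_gt_zero) auto
  have arg: "pi * real j / real n = 2 * real j * x" for j
    using n by (simp add: x_def field_simps)
  \<comment> \<open>Since \<open>1 / n\<close> is \<open>x * (2 / pi)\<close>, this is Jordan's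
    inequality at \<open>x\<close>; the cubic bound gives it because 2/pi <= 2/3 < 15/16.\<close>
  have inv_n: "1 / real n \<le> sin x"
  proof -
    have "1 / real n = x * (2 / pi)"
      using x0 by (simp add: nx)
    also have "\<dots> \<le> x * (1 - x\<^sup>2 / 4)"
    proof (rule mult_left_mono)
      have "2 / pi \<le> 15 / 16"
        using pi_ge_3 by (simp add: field_simps)
      then show "2 / pi \<le> 1 - x\<^sup>2 / 4"
        using x2 by linarith
    qed (use x0 in simp)
    finally show ?thesis using sin1 by linarith
  qed
  \<comment> \<open>Here \<open>2 * j + 1 <= n\<close>, so the angle stays at least \<open>x\<close>
    below the right angle and its cosine is at least \<open>sin x\<close>, which dominates
    \<open>1 / n\<close>.\<close>
  have pos: "0 \<le> a j" if "j < K" for j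
  proof -
    have "2 * j + 1 \<le> n"
      using that by (simp add: K_def)
    then have "(2 * real j + 1) * x \<le> real n * x"
      using x0 by (intro mult_right_mono) auto
    then have "2 * real j * x \<le> pi / 2 - x"
      using x0 by (simp add: nx algebra_simps)
    then have "cos (pi / 2 - x) \<le> cos (2 * real j * x)"
      using x0 xpi by (intro cos_monotone_0_pi_le) auto
    then have "sin x \<le> cos (2 * real j * x)"
      by (simp add: cos_diff)
    with inv_n show ?thesis
      by (simp add: a_def arg)
  qed
  \<comment> \<open>Now \<open>n <= 2 * j\<close>, so the angle lies between pi/2 and pi and the
    cosine itself is nonpositive.\<close>
  have neg: "a j \<le> 0" if "j \<in> {K..<n}" for j
  proof -
    have "n \<le> 2 * j" and "2 * j \<le> 2 * n"
      using that by (auto simp: K_def)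
    then have "real n * x \<le> (2 * real j) * x" "(2 * real j) * x \<le> (2 * real n) * x"
      using x0 by (auto intro!: mult_right_mono)
    then have "pi / 2 \<le> 2 * real j * x" "2 * real j * x \<le> pi"
      using x0 by (simp_all add: nx)
    then have "cos (2 * real j * x) \<le> cos (pi / 2)"
      by (intro cos_monotone_0_pi_le) auto
    then have "cos (2 * real j * x) \<le> 0" by simp
    moreover have "0 \<le> 2 / real n" by simp
    ultimately show ?thesis
      unfolding a_def arg by linarith
  qed
  have dirichlet: "(\<Sum>j<k. a j) = 1 + sin ((2 * real k - 1) * x) / sin x - 2 * real k / real n" for k
    using sum_cos_Dirichlet[of x k] sin0
    by (simp add: a_def arg sum_subtractf field_simps flip: sum_distrib_left)
  have "(2 * real n - 1) * x = pi - x"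
    using x0 by (simp add: nx algebra_simps)
  then have total: "(\<Sum>j<n. a j) = 0"
    using dirichlet[of n] sin0 n by simp
  have split: "(\<Sum>j<n. f j) = (\<Sum>j<K. f j) + (\<Sum>j\<in>{K..<n}. f j)" for f :: "nat \<Rightarrow> real"
    using sum.atLeastLessThan_concat[of 0 K n f] by (simp add: K_def atLeast0LessThan)
  have "(\<Sum>j<n. \<bar>a j\<bar>) = (\<Sum>j<K. a j) - (\<Sum>j\<in>{K..<n}. a j)"
    unfolding split by (simp add: pos neg sum_negf)
  then have energy: "(\<Sum>j<n. \<bar>a j\<bar>) = 2 * (1 + sin ((2 * real K - 1) * x) / sin x - 2 * real K / real n)"
    using total split[of a] by (simp add: dirichlet[symmetric])
  \<comment> \<open>The parity of \<open>n\<close> decides the Dirichlet term: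
    \<open>(2 * K - 1) * x\<close> is \<open>pi / 2 - x\<close> for even \<open>n\<close> and
    \<open>pi / 2\<close> for odd \<open>n\<close>.\<close>
  have "(\<Sum>j<n. \<bar>a j\<bar>) \<le> 2 / x"
  proof (cases "even n")
    case True
    then have K: "2 * real K = real n"
      by (auto simp: K_def elim!: evenE)
    have "(2 * real K - 1) * x = pi / 2 - x"
      using x0 unfolding K by (simp add: nx algebra_simps)
    then have "(\<Sum>j<n. \<bar>a j\<bar>) = 2 * (cos x / sin x)"
      using n by (simp add: energy K sin_diff)
    moreover have "x * cos x \<le> sin x"
    proof -
      \<comment> \<open>From cos x = 1 - 2 sin^2 (x/2) and sin (x/2) >= (15/16) (x/2): the squared
        factor 225/1024 exceeds 1/8.\<close>
      have "cos x \<le> 1 - x\<^sup>2 / 4"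
      proof -
        have "15 / 16 \<le> 1 - (x / 2)\<^sup>2 / 4"
          unfolding power_divide using x2 by simp
        then have h: "x / 2 * (15 / 16) \<le> x / 2 * (1 - (x / 2)\<^sup>2 / 4)"
          using x0 by (intro mult_left_mono) auto
        have "x / 2 * (1 - (x / 2)\<^sup>2 / 4) \<le> sin (x / 2)"
          using x0 xpi by (intro sin_ge_cubic) auto
        then have "x / 2 * (15 / 16) \<le> sin (x / 2)"
          using h by linarith
        then have "(x / 2 * (15 / 16))\<^sup>2 \<le> (sin (x / 2))\<^sup>2"
          using x0 by (intro power_mono) auto
        then have "225 * x\<^sup>2 \<le> 1024 * (sin (x / 2))\<^sup>2"
          by (simp add: power_divide power_mult_distrib mult.commute)
        then have "x\<^sup>2 / 8 \<le> (sin (x / 2))\<^sup>2"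
          using zero_le_power2[of x] by linarith
        then show ?thesis
          using cos_double_sin[of "x / 2"] by simp
      qed
      then have "x * cos x \<le> x * (1 - x\<^sup>2 / 4)"
        using x0 by (intro mult_left_mono) auto
      then show ?thesis using sin1 by linarith
    qed
    then have "cos x / sin x \<le> 1 / x"
      using sin0 x0 by (simp add: field_simps)
    ultimately show ?thesis
      by simp
  next
    case False
    then have K: "2 * real K = real n + 1"
      by (auto simp: K_def elim!: oddE)
    have "(2 * real K - 1) * x = pi / 2"
      using x0 unfolding K by (simp add: nx)
    then have "sin ((2 * real K - 1) * x) = 1"
      by (simp only: sin_pi_half)
    then have "(\<Sum>j<n. \<bar>a j\<bar>) = 2 * (1 + 1 / sin x - (real n + 1) / real n)"
      unfolding energy K by simp
    then have "(\<Sum>j<n. \<bar>a j\<bar>) = 2 * (1 / sin x - 1 / real n)"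
      using n by (simp add: add_divide_distrib)
    also have "1 / sin x \<le> 1 / (x * (1 - x\<^sup>2 / 4))"
      using sin1 sin0 x0 x2 by (intro divide_left_mono) (auto intro!: mult_pos_pos)
    \<comment> \<open>The excess \<open>x / 2\<close> over \<open>1 / x\<close> is tailored to the
      subtracted \<open>1 / n\<close>: as \<open>1 / n = 2 * x / pi\<close> and pi < 4, the latter
      absorbs it.\<close>
    also have "1 / (x * (1 - x\<^sup>2 / 4)) \<le> 1 / x + x / 2"
    proof -
      have "1 \<le> (1 + x\<^sup>2 / 2) * (1 - x\<^sup>2 / 4)"
      proof -
        have "(1 + x\<^sup>2 / 2) * (1 - x\<^sup>2 / 4) = 1 + x\<^sup>2 * (1 / 4 - x\<^sup>2 / 8)"
          by (simp add: algebra_simps)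
        then show ?thesis using x2 by simp
      qed
      then have "1 / (1 - x\<^sup>2 / 4) \<le> 1 + x\<^sup>2 / 2"
        using x2 by (simp add: divide_le_eq)
      then have "1 / (1 - x\<^sup>2 / 4) / x \<le> (1 + x\<^sup>2 / 2) / x"
        using x0 by (intro divide_right_mono) auto
      then show ?thesis
        using x0 by (simp add: add_divide_distrib power2_eq_square mult.commute)
    qed
    also have "x / 2 \<le> 1 / real n"
    proof -
      have "x * (1 / 2) \<le> x * (2 / pi)"
        using x0 pi_half_less_two by (intro mult_left_mono) (auto simp: field_simps)
      then show ?thesis using x0 by (simp add: nx)
    qed
    finally show ?thesis by simp
  qed
  then show ?thesis
    using n by (simp add: a_def x_def)
qed

subsection \<open>The energy of a connected graph\<close>

lemma (in graph) sum_abs_degree_deviation_le_laplacian_energy: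
  "(\<Sum>v\<in>verts G. \<bar>real (out_degree G v) - average_degree G\<bar>) \<le> laplacian_energy G"
proof -
  obtain xs where xs: "distinct xs" "set xs = verts G"
    using finite_distinct_list[OF finite_verts] by blast
  have "laplacian_mat G xs $$ (i, i) = real (out_degree G (xs ! i))" if "i < length xs" for i
    using that adj_not_same by (auto simp: laplacian_mat_index)
  then have "(\<Sum>v\<in>verts G. \<bar>real (out_degree G v) - average_degree G\<bar>) =
      (\<Sum>i<length xs. \<bar>laplacian_mat G xs $$ (i, i) - average_degree G\<bar>)"
    by (simp add: sum_verts_conv_nth[OF xs])
  also have "\<dots> \<le> (\<Sum>\<mu>\<in>#laplacian_eigenvalues G. \<bar>\<mu> - average_degree G\<bar>)"
    unfolding laplacian_eigenvalues_eq[OF xs]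
    by (rule sum_abs_diagonal_le_sum_abs_eigenvalues[OF laplacian_mat_carrier transpose_laplacian_mat])
  finally show ?thesis
    by (simp add: laplacian_energy_def)
qed

text \<open>The degree deviations sum to zero, so the pendent and the internal vertices contribute
  the same amount \<open>(n - s) * (t - 1)\<close>. This is nondecreasing in the average degree
  \<open>t\<close>, which connectedness bounds below by \<open>2 - 2 / n\<close>.\<close>

lemma (in graph) connected_laplacian_energy_ge:
  assumes conn: "Digraph_Component.connected G" and n: "card (verts G) = n" "n \<ge> 2"
    and s: "card (internal_verts G) = s"
  shows "2 * (real n - real s - 2 + 2 * real s / real n) \<le> laplacian_energy G"
proof -
  let ?I = "internal_verts G" and ?V = "verts G" and ?m = "real (card (edges G))"
  let ?d = "\<lambda>v. real (out_degree G v)"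
  define t where "t = average_degree G"
  have I: "?I \<subseteq> ?V"
    by (auto simp: internal_verts_def)
  have sn: "s \<le> n"
    using card_mono[OF finite_verts I] n s by simp
  have pendent: "?d v = 1" if "v \<in> ?V - ?I" for v
    using that connected_out_degree_pos[OF conn, of v] n by (auto simp: internal_verts_def)
  have card_pendent: "real (card (?V - ?I)) = real n - real s"
    using n s sn card_Diff_subset[OF finite_subset[OF I finite_verts] I] by (simp add: of_nat_diff)
  have split: "(\<Sum>v\<in>?V. f v) = (\<Sum>v\<in>?V - ?I. f v) + (\<Sum>v\<in>?I. f v)" for f :: "'a \<Rightarrow> real"
    by (rule sum.subset_diff[OF I finite_verts])
  have "(\<Sum>v\<in>?V. ?d v) = 2 * ?m"
    using handshake by (metis of_nat_sum of_nat_mult of_nat_numeral)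
  then have sum_internal: "(\<Sum>v\<in>?I. ?d v) = 2 * ?m - (real n - real s)"
    using split[of ?d] by (simp add: pendent card_pendent)
  \<comment> \<open>Each absolute value is bounded below by one of its two signed versions, chosen
    by the kind of vertex. In a tree nothing is lost, since the average degree then lies between 1
    and 2.\<close>
  have "(\<Sum>v\<in>?V - ?I. t - ?d v) + (\<Sum>v\<in>?I. ?d v - t) \<le> (\<Sum>v\<in>?V. \<bar>?d v - t\<bar>)"
    unfolding split by (intro add_mono sum_mono) auto
  also have "\<dots> \<le> laplacian_energy G"
    unfolding t_def by (rule sum_abs_degree_deviation_le_laplacian_energy)
  also have "(\<Sum>v\<in>?V - ?I. t - ?d v) = (real n - real s) * (t - 1)"
    by (simp add: pendent card_pendent)
  also have "(\<Sum>v\<in>?I. ?d v - t) = 2 * ?m - (real n - real s) - real s * t"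
    by (simp add: sum_subtractf sum_internal s)
  finally have *: "(real n - real s) * (t - 1) + (2 * ?m - (real n - real s) - real s * t) \<le> laplacian_energy G" .
  have m: "2 * ?m = real n * t"
    using n by (simp add: t_def average_degree_def)
  have "real n \<le> ?m + 1"
    using connected_card_verts_le[OF conn] n by linarith
  then have "2 * (real n - 1) \<le> real n * t"
    unfolding m[symmetric] by simp
  then have "2 - 2 / real n \<le> t"
    using n by (simp add: field_simps)
  then have "2 * (real n - real s) * (2 - 2 / real n - 1) \<le> 2 * (real n - real s) * (t - 1)"
    using sn by (intro mult_left_mono) auto
  \<comment> \<open>Substituting \<open>2 * m = n * t\<close> turns the internal contribution into a
    second copy of the pendent one.\<close>
  also have "\<dots> = (real n - real s) * (t - 1) + (2 * ?m - (real n - real s) - real s * t)"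
    unfolding m by (simp add: algebra_simps)
  also note *
  also have "2 * (real n - real s) * (2 - 2 / real n - 1) = 2 * (real n - real s - 2 + 2 * real s / real n)"
    using n by (simp add: field_simps)
  finally show ?thesis .
qed

theorem theorem3p1:
  fixes T :: "('a, 'b) pre_digraph" and n s :: nat
  assumes "undirected_tree T"
    and "card (verts T) = n"
    and "n \<ge> 4"
    and "card (internal_verts T) = s"
    and "((pi - 2) / pi) * real n \<ge> real s + 2 - 2 * real s / real n"
  shows "laplacian_energy T \<ge> laplacian_energy (path_graph n)"
proof -
  interpret graph T
    using assms(1) by (simp add: undirected_tree_def)
  have "laplacian_energy (path_graph n) \<le> 4 * real n / pi"
    using sum_abs_path_eigenvalues_le[OF assms(3)] laplacian_energy_path_graph[of n] assms(3) by simp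
  also have "\<dots> \<le> 2 * (real n - real s - 2 + 2 * real s / real n)"
  proof -
    \<comment> \<open>Written this way, the hypothesis is half of the comparison between the upper
      bound for the path and the lower bound for \<open>T\<close>.\<close>
    have "((pi - 2) / pi) * real n = real n - 2 * (real n / pi)"
      by (simp add: field_simps)
    then have "2 * (real n / pi) \<le> real n - real s - 2 + 2 * real s / real n"
      using assms(5) by simp
    then show ?thesis
      by simp
  qed
  also have "\<dots> \<le> laplacian_energy T"
    using assms by (intro connected_laplacian_energy_ge) (auto simp: undirected_tree_def)
  finally show ?thesis .
qed

end
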